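(* Let $\mathfrak g$ be one of the matrix Lie algebras $\mathfrak{gl}(n)$, $\mathfrak{sl}(n)$, $\mathfrak{so}(n)$, $\mathfrak u(n)$, $\mathfrak o(p,q)$, $\mathfrak{sp}(2n)$, let $l_0$ be a matrix in the corresponding ambient matrix space, and let $P=\mathrm{proj}_{\mathfrak g}(l_0)$ be given by the explicit formula for $\mathfrak g$ listed in the context. Then $P\in\mathfrak g$, i.e. $P$ satisfies the defining relation of $\mathfrak g$: no condition for $\mathfrak{gl}(n)$; $\mathrm{tr}\,P=0$ for $\mathfrak{sl}(n)$; $P^{T}=-P$ for $\mathfrak{so}(n)$; $P^\dagger=-P$ for $\mathfrak u(n)$; $P^{T}\eta+\eta P=0$ for $\mathfrak o(p,q)$; and $P^{T}J+JP=0$ for $\mathfrak{sp}(2n)$.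
   Context: $\mathbb F$ denotes $\mathbb R$ or $\mathbb C$; $M_n(\mathbb F)$ is the space of $n\times n$ matrices over $\mathbb F$, $n\ge1$; $A^T$ is the transpose and $A^\dagger$ the conjugate transpose. $\eta$ is the diagonal matrix of size $p+q\ge 1$ with $p$ diagonal entries $+1$ and $q$ diagonal entries $-1$. $J=\begin{bmatrix}0&I_n\\-I_n&0\end{bmatrix}$, of size $2n$. The algebras, their ambient matrix spaces, and the maps $\mathrm{proj}_{\mathfrak g}$ are: (1) $\mathfrak{gl}(n)=M_n(\mathbb F)$, ambient $M_n(\mathbb F)$, $\mathrm{proj}(l_0)=l_0$. (2) $\mathfrak{sl}(n)=\{A\in M_n(\mathbb F):\mathrm{tr}\,A=0\}$, ambient $M_n(\mathbb F)$, $\mathrm{proj}(l_0)=l_0-\frac{\mathrm{tr}\,l_0}{n}I$. (3) $\mathfrak{so}(n)=\{A\in M_n(\mathbb R):A^T=-A\}$, ambient $M_n(\mathbb R)$, $\mathrm{proj}(l_0)=\frac12(l_0-l_0^T)$. (4) $\mathfrak u(n)=\{A\in M_n(\mathbb C):A^\dagger=-A\}$, ambient $M_n(\mathbb C)$, $\mathrm{proj}(l_0)=\frac12(l_0-l_0^\dagger)$. (5) $\mathfrak o(p,q)=\{A\in M_{p+q}(\mathbb R):A^T\eta+\eta A=0\}$, ambient $M_{p+q}(\mathbb R)$, $\mathrm{proj}(l_0)=\frac12(l_0-\eta l_0^T\eta)$. (6) $\mathfrak{sp}(2n)=\{A\in M_{2n}(\mathbb F):A^TJ+JA=0\}$, ambient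 $M_{2n}(\mathbb F)$, $\mathrm{proj}(l_0)=\frac12(l_0+J^Tl_0^TJ^T)$. *)

theory Defs
  imports "Jordan_Normal_Form.Schur_Decomposition"
begin

definition mat_trace :: "'a::comm_monoid_add mat \<Rightarrow> 'a" where
  "mat_trace A = sum_list (diag_mat A)"

definition eta_mat :: "nat \<Rightarrow> nat \<Rightarrow> real mat" where
  "eta_mat p q = mat_diag (p + q) (\<lambda>i. if i < p then 1 else - 1)"

definition J_mat :: "nat \<Rightarrow> 'a::ring_1 mat" where
  "J_mat n = four_block_mat (0\<^sub>m n n) (1\<^sub>m n) (- 1\<^sub>m n) (0\<^sub>m n n)"

definition lie_gl :: "nat \<Rightarrow> 'a::field mat set" where
  "lie_gl n = carrier_mat n n"

definition lie_sl :: "nat \<Rightarrow> 'a::field mat set" where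
  "lie_sl n = {A \<in> carrier_mat n n. mat_trace A = 0}"

definition lie_so :: "nat \<Rightarrow> real mat set" where
  "lie_so n = {A \<in> carrier_mat n n. transpose_mat A = - A}"

definition lie_u :: "nat \<Rightarrow> complex mat set" where
  "lie_u n = {A \<in> carrier_mat n n. mat_adjoint A = - A}"

definition lie_o :: "nat \<Rightarrow> nat \<Rightarrow> real mat set" where
  "lie_o p q = {A \<in> carrier_mat (p + q) (p + q).
     transpose_mat A * eta_mat p q + eta_mat p q * A = 0\<^sub>m (p + q) (p + q)}"

text \<open>The parameter \<open>n\<close> of \<open>lie_sp\<close>, like that of \<open>J_mat\<close>, is half the matrix size.\<close>

definition lie_sp :: "nat \<Rightarrow> 'a::field mat set" where
  "lie_sp n = {A \<in> carrier_mat (2 * n) (2 * n).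
     transpose_mat A * J_mat n + J_mat n * A = 0\<^sub>m (2 * n) (2 * n)}"

definition proj_gl :: "'a::field mat \<Rightarrow> 'a mat" where
  "proj_gl L = L"

definition proj_sl :: "nat \<Rightarrow> 'a::field mat \<Rightarrow> 'a mat" where
  "proj_sl n L = L - (mat_trace L / of_nat n) \<cdot>\<^sub>m 1\<^sub>m n"

definition proj_so :: "real mat \<Rightarrow> real mat" where
  "proj_so L = (1 / 2) \<cdot>\<^sub>m (L - transpose_mat L)"

definition proj_u :: "complex mat \<Rightarrow> complex mat" where
  "proj_u L = (1 / 2) \<cdot>\<^sub>m (L - mat_adjoint L)"

definition proj_o :: "nat \<Rightarrow> nat \<Rightarrow> real mat \<Rightarrow> real mat" where
  "proj_o p q L = (1 / 2) \<cdot>\<^sub>m (L - eta_mat p q * transpose_mat L * eta_mat p q)"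

definition proj_sp :: "nat \<Rightarrow> 'a::field mat \<Rightarrow> 'a mat" where
  "proj_sp n L = (1 / 2) \<cdot>\<^sub>m
     (L + transpose_mat (J_mat n) * transpose_mat L * transpose_mat (J_mat n))"

end

theory Submission
  imports Defs
begin

text \<open>Each \<open>proj\<close> is the projection onto one summand of a splitting of the ambient space.

For \<open>gl\<close> there is nothing to remove. For \<open>sl\<close> the trace is linear and the identity of size
\<open>n\<close> has trace \<open>n\<close>, so subtracting the scalar matrix of the same trace leaves trace zero.

In the other four cases the algebra consists of the matrices \<open>A\<close> with \<open>\<sigma> A = - A\<close> for an
involution \<open>\<sigma>\<close>, and \<open>proj\<close> takes the skew part \<open>(L - \<sigma> L) / 2\<close>: applying \<open>\<sigma>\<close> exchanges the
two terms and so changes the sign. For \<open>so\<close> and \<open>u\<close> the involution is the transpose or the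
conjugate transpose. For \<open>o\<close> and \<open>sp\<close> it is the adjoint \<open>\<sigma> L = K\<^sup>T L\<^sup>T K\<close> with respect to the
bilinear form with Gram matrix \<open>K\<close>, equal to \<open>\<eta>\<close> or \<open>J\<close>. Both Gram matrices are orthogonal, so
multiplying \<open>A\<^sup>T K + K A = 0\<close> by \<open>K\<^sup>T = K\<^sup>-\<^sup>1\<close> from the left turns the defining relation into
\<open>\<sigma> A = - A\<close>; and they are symmetric or antisymmetric, which makes \<open>\<sigma>\<close> an involution. The lemma
\<open>skew_part_in_form_algebra\<close> treats both cases from these two properties of \<open>K\<close>.\<close>

lemma proj_sl_in_lie_sl:
  fixes L :: "'a::field mat"
  assumes L: "L \<in> carrier_mat n n" and n: "of_nat n \<noteq> (0::'a)"
  shows "proj_sl n L \<in> lie_sl n"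
proof -
  define c where "c = mat_trace L / of_nat n"
  have tr: "mat_trace A = (\<Sum>i<n. A $$ (i, i))" if "A \<in> carrier_mat n n" for A :: "'a mat"
    using that
    by (simp add: mat_trace_def diag_mat_def interv_sum_list_conv_sum_set_nat atLeast0LessThan)
  have P: "L - c \<cdot>\<^sub>m 1\<^sub>m n \<in> carrier_mat n n" using L by auto
  have "mat_trace (L - c \<cdot>\<^sub>m 1\<^sub>m n) = (\<Sum>i<n. L $$ (i, i) - c)"
    unfolding tr[OF P] using L by (intro sum.cong) auto
  also have "\<dots> = mat_trace L - of_nat n * c"
    using tr[OF L] by (simp add: sum_subtractf)
  also have "\<dots> = 0" using n by (simp add: c_def)
  finally show ?thesis using P by (simp add: lie_sl_def proj_sl_def c_def)
qed

lemma proj_so_in_lie_so: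
  assumes "L \<in> carrier_mat n n"
  shows "proj_so L \<in> lie_so n"
  using assms by (auto simp: lie_so_def proj_so_def field_simps intro!: eq_matI)

lemma proj_u_in_lie_u:
  assumes L: "L \<in> carrier_mat n n"
  shows "proj_u L \<in> lie_u n"
proof -
  have adj: "mat_adjoint A = mat n n (\<lambda>(i, j). cnj (A $$ (j, i)))"
    if "A \<in> carrier_mat n n" for A :: "complex mat"
    using that by (intro eq_matI) (auto simp: mat_adjoint_def mat_of_rows_def)
  have P: "proj_u L \<in> carrier_mat n n" using L by (auto simp: proj_u_def adj)
  have "mat_adjoint (proj_u L) = - proj_u L"
    unfolding adj[OF P] using L by (intro eq_matI) (auto simp: proj_u_def adj field_simps)
  with P show ?thesis by (simp add: lie_u_def)
qed

text \<open>The two terms contributed by \<open>L\<close> to the defining relation cancel the two contributed by its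
adjoint \<open>K\<^sup>T L\<^sup>T K\<close>, crosswise. Orthogonality gives \<open>K (K\<^sup>T L\<^sup>T K) = L\<^sup>T K\<close>. The transpose of the
adjoint is \<open>K\<^sup>T L K\<close>; since \<open>K\<^sup>T\<close> and \<open>K\<close> differ by a scalar only, the superscript can be moved
across \<open>L\<close>, so \<open>(K\<^sup>T L K) K = K L (K\<^sup>T K) = K L\<close>. The factor \<open>c\<close> is arbitrary because the relation
is linear.\<close>

lemma skew_part_in_form_algebra:
  fixes K L :: "'a::comm_ring_1 mat" and c e :: 'a
  assumes K: "K \<in> carrier_mat m m" and L: "L \<in> carrier_mat m m"
    and sym: "transpose_mat K = e \<cdot>\<^sub>m K"
    and orth: "transpose_mat K * K = 1\<^sub>m m"
  defines "P \<equiv> c \<cdot>\<^sub>m (L - transpose_mat K * transpose_mat L * K)"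
  shows "transpose_mat P * K + K * P = 0\<^sub>m m m"
proof -
  let ?T = transpose_mat
  note [simp] = K L
  have [simp]: "A * B \<in> carrier_mat m m"
    if "A \<in> carrier_mat m m" "B \<in> carrier_mat m m" for A B :: "'a mat"
    using that by (rule mult_carrier_mat)
  note assoc = assoc_mult_mat[where n\<^sub>1 = m and n\<^sub>2 = m and n\<^sub>3 = m and n\<^sub>4 = m]
  note smult = mult_smult_distrib[where nr = m and n = m and nc = m]
    mult_smult_assoc_mat[where nr = m and n = m and nc = m]
  define N where "N = ?T K * ?T L * K"
  have N [simp]: "N \<in> carrier_mat m m" by (simp add: N_def)
  have "K * ?T K = ?T K * K" by (simp add: sym smult)
  then have KN: "K * N = ?T L * K"
    using assoc[of K "?T K" "?T L * K"] by (simp add: N_def assoc orth left_mult_one_mat[where nc = m])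
  have "?T N = ?T K * (L * K)"
    by (simp add: N_def transpose_mult[where n = m and nr = m and nc = m] assoc)
  also have "\<dots> = (K * L) * ?T K"
    by (simp add: sym smult assoc)
  finally have NK: "?T N * K = K * L"
    by (simp add: assoc orth right_mult_one_mat[where nr = m])
  have P: "P = c \<cdot>\<^sub>m (L - N)" "?T P = c \<cdot>\<^sub>m (?T L - ?T N)"
    using L N by (auto simp: P_def N_def[symmetric] intro!: eq_matI simp del: K L N)
  have D: "L - N \<in> carrier_mat m m" "?T L - ?T N \<in> carrier_mat m m"
    by (auto intro!: minus_carrier_mat)
  have "?T P * K = c \<cdot>\<^sub>m (?T L * K - K * L)"
    using D by (simp add: P(2) smult NK minus_mult_distrib_mat[where nr = m and n = m and nc = m])
  moreover have "K * P = c \<cdot>\<^sub>m (K * L - ?T L * K)"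
    using D by (simp add: P(1) smult KN mult_minus_distrib_mat[where nr = m and n = m and nc = m])
  moreover have "c \<cdot>\<^sub>m (A - B) + c \<cdot>\<^sub>m (B - A) = 0\<^sub>m m m"
    if "A \<in> carrier_mat m m" "B \<in> carrier_mat m m" for A B :: "'a mat"
    using that by (intro eq_matI) (auto simp: algebra_simps)
  ultimately show ?thesis by simp
qed

lemma eta_mat_carrier: "eta_mat p q \<in> carrier_mat (p + q) (p + q)"
  by (simp add: eta_mat_def mat_diag_def)

lemma eta_mat_symmetric: "transpose_mat (eta_mat p q) = eta_mat p q"
  by (intro eq_matI) (auto simp: eta_mat_def mat_diag_def)

lemma eta_mat_square: "eta_mat p q * eta_mat p q = 1\<^sub>m (p + q)"
  by (simp add: eta_mat_def if_distrib[of "\<lambda>x. x * _"] cong: if_cong)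

lemma proj_o_in_lie_o:
  assumes L: "L \<in> carrier_mat (p + q) (p + q)"
  shows "proj_o p q L \<in> lie_o p q"
proof -
  note eta = eta_mat_carrier[of p q]
  have "proj_o p q L \<in> carrier_mat (p + q) (p + q)"
    using L eta by (auto simp: proj_o_def intro!: minus_carrier_mat mult_carrier_mat)
  moreover have "eta_mat p q = 1 \<cdot>\<^sub>m eta_mat p q" by (intro eq_matI) auto
  ultimately show ?thesis
    using skew_part_in_form_algebra[OF eta L, of 1 "1 / 2"]
    by (simp add: lie_o_def proj_o_def eta_mat_symmetric eta_mat_square)
qed

lemma J_mat_carrier: "J_mat n \<in> carrier_mat (2 * n) (2 * n)"
  by (auto simp: J_mat_def mult_2)

lemma J_mat_antisymmetric: "transpose_mat (J_mat n) = (- 1) \<cdot>\<^sub>m J_mat n"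
  by (intro eq_matI) (auto simp: J_mat_def)

lemma J_mat_orthogonal: "transpose_mat (J_mat n) * J_mat n = (1\<^sub>m (2 * n) :: 'a::comm_ring_1 mat)"
proof -
  have "transpose_mat (J_mat n) = four_block_mat (0\<^sub>m n n) (- 1\<^sub>m n) (1\<^sub>m n) (0\<^sub>m n n :: 'a mat)"
    by (intro eq_matI) (auto simp: J_mat_def)
  moreover have "- 0\<^sub>m n n = (0\<^sub>m n n :: 'a mat)" by (intro eq_matI) auto
  ultimately have "transpose_mat (J_mat n) * J_mat n
      = four_block_mat (1\<^sub>m n) (0\<^sub>m n n) (0\<^sub>m n n) (1\<^sub>m n :: 'a mat)"
    by (simp add: J_mat_def
        mult_four_block_mat[OF zero_carrier_mat uminus_carrier_mat[OF one_carrier_mat]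
          one_carrier_mat zero_carrier_mat zero_carrier_mat one_carrier_mat
          uminus_carrier_mat[OF one_carrier_mat] zero_carrier_mat])
  then show ?thesis by (simp add: mult_2)
qed

lemma proj_sp_in_lie_sp:
  fixes L :: "'a::field mat"
  assumes L: "L \<in> carrier_mat (2 * n) (2 * n)"
  shows "proj_sp n L \<in> lie_sp n"
proof -
  let ?J = "J_mat n :: 'a mat"
  note J = J_mat_carrier[of n, where 'a = 'a]
  have A: "transpose_mat ?J * transpose_mat L \<in> carrier_mat (2 * n) (2 * n)"
    using L J by (auto intro!: mult_carrier_mat)
  have B: "transpose_mat ?J * transpose_mat L * ?J \<in> carrier_mat (2 * n) (2 * n)"
    using A J by (rule mult_carrier_mat)
  \<comment> \<open>Transposing the right-hand \<open>J\<close> accounts for the plus sign in the projection formula.\<close>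
  have "transpose_mat ?J * transpose_mat L * transpose_mat ?J
      = (- 1) \<cdot>\<^sub>m (transpose_mat ?J * transpose_mat L * ?J)"
    unfolding J_mat_antisymmetric[of n]
    using mult_smult_distrib[OF A J, of "- 1"] by (simp add: J_mat_antisymmetric)
  then have P: "proj_sp n L = (1 / 2) \<cdot>\<^sub>m (L - transpose_mat ?J * transpose_mat L * ?J)"
    unfolding proj_sp_def using L B by (intro eq_matI) auto
  moreover have "proj_sp n L \<in> carrier_mat (2 * n) (2 * n)"
    unfolding P using B by (intro smult_carrier_mat minus_carrier_mat)
  ultimately show ?thesis
    using skew_part_in_form_algebra[OF J L J_mat_antisymmetric J_mat_orthogonal, of "1 / 2"]
    by (simp add: lie_sp_def)
qed

theorem theorem1:
  shows
   "(\<forall>n\<ge>1. \<forall>L \<in> (carrier_mat n n :: real mat set). proj_gl L \<in> lie_gl n) \<and>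
    (\<forall>n\<ge>1. \<forall>L \<in> (carrier_mat n n :: complex mat set). proj_gl L \<in> lie_gl n) \<and>
    (\<forall>n\<ge>1. \<forall>L \<in> (carrier_mat n n :: real mat set). proj_sl n L \<in> lie_sl n) \<and>
    (\<forall>n\<ge>1. \<forall>L \<in> (carrier_mat n n :: complex mat set). proj_sl n L \<in> lie_sl n) \<and>
    (\<forall>n\<ge>1. \<forall>L \<in> (carrier_mat n n :: real mat set). proj_so L \<in> lie_so n) \<and>
    (\<forall>n\<ge>1. \<forall>L \<in> (carrier_mat n n :: complex mat set). proj_u L \<in> lie_u n) \<and>
    (\<forall>p q. p + q \<ge> 1 \<longrightarrow>
       (\<forall>L \<in> (carrier_mat (p + q) (p + q) :: real mat set). proj_o p q L \<in> lie_o p q)) \<and>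
    (\<forall>n\<ge>1. \<forall>L \<in> (carrier_mat (2 * n) (2 * n) :: real mat set). proj_sp n L \<in> lie_sp n) \<and>
    (\<forall>n\<ge>1. \<forall>L \<in> (carrier_mat (2 * n) (2 * n) :: complex mat set). proj_sp n L \<in> lie_sp n)"
  by (auto simp: proj_gl_def lie_gl_def intro!: proj_sl_in_lie_sl proj_so_in_lie_so
      proj_u_in_lie_u proj_o_in_lie_o proj_sp_in_lie_sp)

end
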